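(* If $n\geq5$ is odd, then $\mathrm{Inn}(\mathrm{R}_n) \neq \mathrm{QInn}(\mathrm{R}_n)$, where $\mathrm{R}_n$ is the dihedral quandle on $n$ elements.
   Context: A quandle is a set $Q$ with a binary operation $*$ such that (1) $x*x=x$ for all $x\in Q$; (2) for every $x\in Q$ the map $S_x:y\mapsto y*x$ is a bijection of $Q$; (3) $(x*y)*z=(x*z)*(y*z)$ for all $x,y,z\in Q$. An automorphism of $Q$ is a bijection preserving $*$; each $S_x$ is an automorphism, and $\mathrm{Inn}(Q)=\langle S_x\mid x\in Q\rangle$. $\mathrm{QInn}(Q)$ denotes the group of all automorphisms $\varphi$ of $Q$ that are quasi-inner in the weak sense: for every $x\in Q$ there exists $S\in\mathrm{Inn}(Q)$ (depending on $x$) with $\varphi(x)=S(x)$. The dihedral quandle $\mathrm{R}_n=\{a_0,\dots,a_{n-1}\}$ has operation $a_i*a_j=a_{2j-i\ (\mathrm{mod}\ n)}$. *)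

theory Defs
  imports "HOL-Algebra.Bij" "HOL-Algebra.Generated_Groups"
begin

record 'a qnd = "'a partial_object" +
  qop :: "'a \<Rightarrow> 'a \<Rightarrow> 'a" (infixl "\<triangleright>\<index>" 70)

text \<open>The symmetry at \<open>x\<close> is right multiplication by \<open>x\<close>. As everywhere in the group
  \<^const>\<open>BijGroup\<close>, permutations of the carrier are made \<^const>\<open>undefined\<close> outside the carrier,
  so that they are determined by their values on it.\<close>

definition qsym :: "('a, 'b) qnd_scheme \<Rightarrow> 'a \<Rightarrow> 'a \<Rightarrow> 'a" where
  "qsym Q x = (\<lambda>y\<in>carrier Q. y \<triangleright>\<^bsub>Q\<^esub> x)"

locale quandle =
  fixes Q (structure)
  assumes op_closed: "\<lbrakk>x \<in> carrier Q; y \<in> carrier Q\<rbrakk> \<Longrightarrow> x \<triangleright> y \<in> carrier Q"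
    and op_idem: "x \<in> carrier Q \<Longrightarrow> x \<triangleright> x = x"
    and sym_bij: "x \<in> carrier Q \<Longrightarrow> bij_betw (qsym Q x) (carrier Q) (carrier Q)"
    and op_distrib: "\<lbrakk>x \<in> carrier Q; y \<in> carrier Q; z \<in> carrier Q\<rbrakk>
      \<Longrightarrow> (x \<triangleright> y) \<triangleright> z = (x \<triangleright> z) \<triangleright> (y \<triangleright> z)"

definition QAut :: "('a, 'b) qnd_scheme \<Rightarrow> ('a \<Rightarrow> 'a) set" where
  "QAut Q = {f \<in> Bij (carrier Q).
     \<forall>x\<in>carrier Q. \<forall>y\<in>carrier Q. f (x \<triangleright>\<^bsub>Q\<^esub> y) = f x \<triangleright>\<^bsub>Q\<^esub> f y}"

definition Inn :: "('a, 'b) qnd_scheme \<Rightarrow> ('a \<Rightarrow> 'a) set" where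
  "Inn Q = generate (BijGroup (carrier Q)) (qsym Q ` carrier Q)"

definition QInn :: "('a, 'b) qnd_scheme \<Rightarrow> ('a \<Rightarrow> 'a) set" where
  "QInn Q = {f \<in> QAut Q. \<forall>x\<in>carrier Q. \<exists>S\<in>Inn Q. f x = S x}"

text \<open>The element \<open>a\<^sub>i\<close> is encoded by its index \<open>i\<close>; indices are integers so that
  \<open>2 * j - i\<close> is not truncated.\<close>

definition dihedral_quandle :: "nat \<Rightarrow> int qnd" where
  "dihedral_quandle n =
     \<lparr>carrier = {0..<int n}, qop = (\<lambda>i j. (2 * j - i) mod int n)\<rparr>"

lemma dihedral_quandle_is_quandle: "quandle (dihedral_quandle n)"
proof -
  let ?Q = "dihedral_quandle n"
  have car: "carrier ?Q = {0..<int n}"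
    and op: "i \<triangleright>\<^bsub>?Q\<^esub> j = (2 * j - i) mod int n" for i j
    by (simp_all add: dihedral_quandle_def)
  have invol: "(2 * x - (2 * x - i) mod int n) mod int n = i" if "i \<in> {0..<int n}" for x i
  proof -
    have "(2 * x - (2 * x - i) mod int n) mod int n = (2 * x - (2 * x - i)) mod int n"
      by (rule mod_diff_right_eq)
    then show ?thesis using that by simp
  qed
  have distrib: "(2 * z - (2 * y - x) mod int n) mod int n
      = (2 * ((2 * z - y) mod int n) - (2 * z - x) mod int n) mod int n" for x y z
  proof -
    have "(2 * z - (2 * y - x) mod int n) mod int n = (2 * z - (2 * y - x)) mod int n"
      by (rule mod_diff_right_eq)
    also have "2 * z - (2 * y - x) = 2 * (2 * z - y) - (2 * z - x)" by simp
    also have "\<dots> mod int n = ((2 * (2 * z - y)) mod int n - (2 * z - x) mod int n) mod int n"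
      by (rule mod_diff_eq [symmetric])
    also have "(2 * (2 * z - y)) mod int n = (2 * ((2 * z - y) mod int n)) mod int n"
      by (rule mod_mult_right_eq [symmetric])
    also have "(\<dots> - (2 * z - x) mod int n) mod int n
        = (2 * ((2 * z - y) mod int n) - (2 * z - x) mod int n) mod int n"
      by (rule mod_diff_left_eq)
    finally show ?thesis .
  qed
  have closed: "(2 * y - x) mod int n \<in> {0..<int n}" if "x \<in> {0..<int n}" for x y
    using that by simp
  have bij: "bij_betw (qsym ?Q x) {0..<int n} {0..<int n}" for x
  proof -
    have q: "qsym ?Q x i = (2 * x - i) mod int n" if "i \<in> {0..<int n}" for i
      using that by (simp only: qsym_def car op restrict_apply if_True)
    have inv: "\<forall>i\<in>{0..<int n}. qsym ?Q x (qsym ?Q x i) = i"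
      by (metis q closed invol)
    have im: "qsym ?Q x ` {0..<int n} \<subseteq> {0..<int n}"
      using q closed by (metis image_subsetI)
    show ?thesis
      by (rule bij_betw_byWitness [OF inv inv im im])
  qed
  show ?thesis
    unfolding quandle_def car op
    by (intro conjI allI impI; (rule closed bij distrib | simp); assumption?)
qed

end

theory Submission
  imports Defs "HOL-Number_Theory.Cong"
begin

text \<open>Every inner automorphism of \<open>R\<^sub>n\<close> has the form \<open>i \<mapsto> c \<plusminus> i\<close>. For odd \<open>n\<close> the number \<open>2\<close> is
  invertible modulo \<open>n\<close>, so doubling is an automorphism, and \<open>Inn(R\<^sub>n)\<close> is transitive because the
  symmetry at \<open>z\<close> sends \<open>x\<close> to \<open>y\<close> when \<open>2 z = x + y\<close>. Hence doubling is quasi-inner, but it is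
  inner only if \<open>2 = 1\<close> or \<open>2 = -1\<close> modulo \<open>n\<close>.\<close>

lemma carrier_dihedral [simp]: "carrier (dihedral_quandle n) = {0..<int n}"
  and qop_dihedral [simp]: "i \<triangleright>\<^bsub>dihedral_quandle n\<^esub> j = (2 * j - i) mod int n"
  by (simp_all add: dihedral_quandle_def)

lemma qsym_dihedral:
  "i \<in> {0..<int n} \<Longrightarrow> qsym (dihedral_quandle n) x i = (2 * x - i) mod int n"
  by (simp add: qsym_def)

lemma (in quandle) qsym_in_Bij: "x \<in> carrier Q \<Longrightarrow> qsym Q x \<in> Bij (carrier Q)"
  using sym_bij by (simp add: Bij_def qsym_def)

text \<open>Slopes multiply under composition, so a group generated by maps of slope -1 only
  contains slopes 1 and -1. Membership in \<open>Bij\<close> is carried through the induction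
  because the product of \<open>BijGroup\<close> is given by composition only on members of
  \<open>Bij\<close>.\<close>

lemma Inn_dihedral_affine:
  assumes "f \<in> Inn (dihedral_quandle n)"
  shows "f \<in> Bij {0..<int n} \<and>
    (\<exists>c e. e \<in> {1, -1} \<and> (\<forall>i\<in>{0..<int n}. f i = (c + e * i) mod int n))"
  using assms unfolding Inn_def carrier_dihedral
proof (induction rule: generate.induct)
  case one
  have "(\<forall>i\<in>{0..<int n}. \<one>\<^bsub>BijGroup {0..<int n}\<^esub> i = (0 + 1 * i) mod int n)"
    by (simp add: BijGroup_def)
  moreover have "\<one>\<^bsub>BijGroup {0..<int n}\<^esub> \<in> Bij {0..<int n}"
    using id_Bij by (simp add: BijGroup_def)
  ultimately show ?case by blast
next
  case (incl h)
  then obtain x where x: "x \<in> {0..<int n}" "h = qsym (dihedral_quandle n) x" by blast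
  then have "\<forall>i\<in>{0..<int n}. h i = (2 * x + -1 * i) mod int n"
    by (simp add: qsym_dihedral)
  moreover have "h \<in> Bij {0..<int n}"
    using x quandle.qsym_in_Bij[OF dihedral_quandle_is_quandle, of x n] by simp
  ultimately show ?case by blast
next
  case (inv h)
  then obtain x where x: "x \<in> {0..<int n}" "h = qsym (dihedral_quandle n) x" by blast
  have bij: "h \<in> Bij {0..<int n}"
    using x quandle.qsym_in_Bij[OF dihedral_quandle_is_quandle, of x n] by simp
  have "(inv\<^bsub>BijGroup {0..<int n}\<^esub> h) i = (2 * x + -1 * i) mod int n" if i: "i \<in> {0..<int n}" for i
  proof -
    \<comment> \<open>Each symmetry is an involution: solving \<open>i = 2 * x - k\<close> for the
      preimage \<open>k\<close> gives \<open>k = 2 * x - i\<close> modulo \<open>n\<close>, so the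
      inverse has the same formula as \<open>h\<close>.\<close>
    define k where "k = inv_into {0..<int n} h i"
    have img: "h ` {0..<int n} = {0..<int n}"
      using bij by (simp add: Bij_def bij_betw_def)
    have k: "k \<in> {0..<int n}" "h k = i"
      unfolding k_def using i img by (metis inv_into_into, metis f_inv_into_f)
    have "i = (2 * x - k) mod int n" using k x by (simp add: qsym_dihedral)
    then have "(2 * x - i) mod int n = (2 * x - (2 * x - k)) mod int n"
      by (simp only: mod_diff_right_eq)
    then have "(2 * x - i) mod int n = k" using k by simp
    then show ?thesis using bij i by (simp add: inv_BijGroup k_def)
  qed
  moreover have "inv\<^bsub>BijGroup {0..<int n}\<^esub> h \<in> Bij {0..<int n}"
    using group.inv_closed[OF group_BijGroup, of h] bij by (simp add: BijGroup_def)
  ultimately show ?case by blast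
next
  case (eng f g)
  then obtain c e d u where
    f: "f \<in> Bij {0..<int n}" "e \<in> {1, -1}" "\<forall>i\<in>{0..<int n}. f i = (c + e * i) mod int n" and
    g: "g \<in> Bij {0..<int n}" "u \<in> {1, -1}" "\<forall>i\<in>{0..<int n}. g i = (d + u * i) mod int n"
    by blast
  have "(f \<otimes>\<^bsub>BijGroup {0..<int n}\<^esub> g) i = ((c + e * d) + (e * u) * i) mod int n"
    if i: "i \<in> {0..<int n}" for i
  proof -
    have "(f \<otimes>\<^bsub>BijGroup {0..<int n}\<^esub> g) i = f (g i)"
      using f g i by (simp add: BijGroup_def compose_eq)
    also have "\<dots> = (c + e * ((d + u * i) mod int n)) mod int n"
      using f g i by simp
    also have "\<dots> = (c + e * (d + u * i)) mod int n"
      by (metis mod_add_right_eq mod_mult_right_eq)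
    finally show ?thesis by (simp add: algebra_simps)
  qed
  moreover have "f \<otimes>\<^bsub>BijGroup {0..<int n}\<^esub> g \<in> Bij {0..<int n}"
    using f g by (simp add: BijGroup_def compose_Bij)
  moreover have "e * u \<in> {1, -1}" using f g by auto
  ultimately show ?case by blast
qed

lemma Inn_dihedral_transitive:
  assumes "odd n" and x: "x \<in> {0..<int n}" and y: "y \<in> {0..<int n}"
  shows "\<exists>S\<in>Inn (dihedral_quandle n). S x = y"
proof -
  obtain m where m: "int n = 2 * m + 1" using \<open>odd n\<close> by (metis even_of_nat oddE)
  \<comment> \<open>Since \<open>2 * (m + 1) = int n + 1\<close>, the factor \<open>m + 1\<close> is
    the inverse of 2 modulo \<open>n\<close>, and \<open>z\<close> is the midpoint of
    \<open>x\<close> and \<open>y\<close>.\<close>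
  define z where "z = ((x + y) * (m + 1)) mod int n"
  have z: "z \<in> {0..<int n}" using x by (simp add: z_def)
  have "(2 * z - x) mod int n = (2 * ((x + y) * (m + 1)) - x) mod int n"
    unfolding z_def by (metis mod_diff_left_eq mod_mult_right_eq)
  also have "2 * ((x + y) * (m + 1)) - x = y + (x + y) * int n"
    by (simp add: m algebra_simps)
  also have "\<dots> mod int n = y" using y by simp
  finally have "qsym (dihedral_quandle n) z x = y" using x by (simp add: qsym_dihedral)
  moreover have "qsym (dihedral_quandle n) z \<in> Inn (dihedral_quandle n)"
    unfolding Inn_def using z by (intro generate.incl) simp
  ultimately show ?thesis by blast
qed

text \<open>Transitivity makes the weak quasi-inner condition automatic: some inner map sends
  \<open>x\<close> to \<open>f x\<close>, whatever \<open>f\<close> is.\<close>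

lemma QInn_dihedral_eq_QAut:
  assumes "odd n"
  shows "QInn (dihedral_quandle n) = QAut (dihedral_quandle n)"
proof -
  have "\<exists>S\<in>Inn (dihedral_quandle n). f x = S x"
    if "f \<in> QAut (dihedral_quandle n)" "x \<in> {0..<int n}" for f x
  proof -
    have "f x \<in> {0..<int n}"
      using that by (auto simp: QAut_def Bij_def dest: bij_betwE)
    then show ?thesis
      using Inn_dihedral_transitive[OF assms that(2)] by metis
  qed
  then show ?thesis by (auto simp: QInn_def)
qed

text \<open>The operation \<open>2 * j - i\<close> is linear, so multiplication by a constant
  respects it, and it is bijective when the constant is a unit, as 2 is modulo an odd
  number.\<close>

lemma doubling_in_QAut_dihedral:
  assumes "odd n"
  shows "(\<lambda>i\<in>{0..<int n}. (2 * i) mod int n) \<in> QAut (dihedral_quandle n)" (is "?f \<in> _")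
proof -
  have npos: "0 < int n" using assms by (cases n) auto
  have cop: "coprime 2 (int n)" using assms by simp
  have inj: "inj_on ?f {0..<int n}"
  proof (rule inj_onI)
    fix i j assume i: "i \<in> {0..<int n}" and j: "j \<in> {0..<int n}" and "?f i = ?f j"
    then have "[2 * i = 2 * j] (mod int n)" by (simp add: cong_def)
    then have "[i = j] (mod int n)" using cop by (simp add: cong_mult_lcancel)
    then show "i = j" using i j by (simp add: cong_def)
  qed
  have "?f ` {0..<int n} \<subseteq> {0..<int n}" using npos by auto
  then have "?f ` {0..<int n} = {0..<int n}" using inj by (intro endo_inj_surj) auto
  then have "?f \<in> Bij {0..<int n}" using inj by (simp add: Bij_def bij_betw_def)
  moreover have "?f ((2 * y - x) mod int n) = (2 * ?f y - ?f x) mod int n"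
    if "x \<in> {0..<int n}" "y \<in> {0..<int n}" for x y
  proof -
    have "(2 * ((2 * y - x) mod int n)) mod int n = (2 * (2 * y) - 2 * x) mod int n"
      by (simp add: mod_mult_right_eq algebra_simps)
    also have "\<dots> = ((2 * (2 * y)) mod int n - (2 * x) mod int n) mod int n"
      by (simp only: mod_diff_eq)
    also have "(2 * (2 * y)) mod int n = (2 * ((2 * y) mod int n)) mod int n"
      by (simp only: mod_mult_right_eq)
    also have "((2 * ((2 * y) mod int n)) mod int n - (2 * x) mod int n) mod int n
        = (2 * ((2 * y) mod int n) - (2 * x) mod int n) mod int n"
      by (rule mod_diff_left_eq)
    finally show ?thesis using that npos by simp
  qed
  ultimately show ?thesis by (simp add: QAut_def)
qed

theorem proposition8p3:
  fixes n :: nat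
  assumes "n \<ge> 5" and "odd n"
  shows "Inn (dihedral_quandle n) \<noteq> QInn (dihedral_quandle n)"
proof
  let ?f = "\<lambda>i\<in>{0..<int n}. (2 * i) mod int n"
  assume "Inn (dihedral_quandle n) = QInn (dihedral_quandle n)"
  then have "?f \<in> Inn (dihedral_quandle n)"
    using doubling_in_QAut_dihedral QInn_dihedral_eq_QAut \<open>odd n\<close> by simp
  then obtain c e where e: "e \<in> {1, -1}"
    and ce: "\<forall>i\<in>{0..<int n}. ?f i = (c + e * i) mod int n"
    using Inn_dihedral_affine[of ?f n] by blast
  \<comment> \<open>The values at 0 and 1 determine the intercept and the slope modulo
    \<open>n\<close>, forcing \<open>e\<close> to be congruent to 2.\<close>
  have "[c = 0] (mod int n)" using bspec[OF ce, of 0] assms by (simp add: cong_def)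
  moreover have "[c + e = 2] (mod int n)" using bspec[OF ce, of 1] assms by (simp add: cong_def)
  ultimately have "[(c + e) - c = 2 - 0] (mod int n)" by (intro cong_diff)
  then have "[2 = e] (mod int n)" by (simp add: cong_sym)
  then have "int n dvd 2 - e" by (simp add: cong_iff_dvd_diff)
  \<comment> \<open>The difference \<open>2 - e\<close> is 1 or 3, hence too small to be a multiple
    of \<open>n\<close>. For three elements doubling would be negation, the symmetry at 0, and so
    inner.\<close>
  moreover have "0 < 2 - e" "2 - e < int n" using e assms by auto
  ultimately show False using zdvd_not_zless by blast
qed

end
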